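(* Problem (MCSDIPT$_{BH}$) can be solved by Algorithm A (both described in the context) in $O(n\log n)$ time.
   Context: Let $T=(V,E)$ be a tree rooted at $s$ with node set $V=\{s,v_1,\dots,v_n\}$ and edge set $E=\{e_1,\dots,e_n\}$, and let $Y=\{t_1,\dots,t_r\}$ be its set of leaf nodes. Each edge $e$ has an original weight $w(e)$, an upper bound $u(e)$ and a cost $c(e)$, with $u(e)\ge w(e)\ge 0$ and $c(e)>0$. For $t_k\in Y$, $P_k$ is the path from $s$ to $t_k$. For $e\in E$, $L(e)=\{t_k\in Y: e\in P_k\}$. For an edge weight vector $x$, put $x(P_k)=\sum_{e\in P_k}x(e)$ and $x(T)=\sum_{t_k\in Y}x(P_k)$ (the sum of root-leaf distances). $H(a,b)=0$ if $a=b$ and $H(a,b)=1$ if $a\ne b$. Given a value $D$, problem (MCSDIPT$_{BH}$) is: minimize $C(\bar w)=\max_{e\in E}c(e)H(\bar w(e),w(e))$ over $\bar w$ subject to $\bar w(T)\ge D$ and $w(e)\le\bar w(e)\le u(e)$ for all $e\in E$. Put $S(e)=|L(e)|(u(e)-w(e))$. Algorithm A (input $T,n,w,u,c,D$; output $\bar w$ and $C(\bar w)$): 1. For each $e\in E$ determine $L(e)$ and calculate $F(e):=c(e)(u(e)-w(e))$; put $\Delta D:=D-w(T)$; compute $u(T)$. 2. If $u(T)<D$, return "The problem is infeasible" with $\bar w=[\,]$, $C(\bar w)=+\infty$. Else if $w(T)\ge D$, return $[w,0]$. 3. Otherwise sort the edges so that $c(e_{\alpha_1})\le c(e_{\alpha_2})\le\dots\le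 c(e_{\alpha_n})$, and define $g(k)=\sum_{i=1}^kS(e_{\alpha_i})$. 4. Initialize $a:=1$, $b:=n$, $k^*:=0$. While $b-a>1$ and $k^*=0$: put $k:=\lfloor (a+b)/2\rfloor$ and calculate $g(k)$, $g(k+1)$; if $g(k)<\Delta D\le g(k+1)$ put $k^*:=k$; else if $g(k+1)<\Delta D$ put $a:=k$; else put $b:=k$. 5. Put $\bar w(e):=u(e)$ for $e\in\{e_{\alpha_1},\dots,e_{\alpha_{k^*+1}}\}$ and $\bar w(e):=w(e)$ for all other edges; put $C(\bar w):=c(e_{\alpha_{k^*+1}})$. 6. Return $[\bar w,C(\bar w)]$.
   Formalization: Step 4 of Algorithm A starts with a := 0 instead of a := 1, since the printed start can return an infeasible vector (star with two edges, w = 0, u = c = 1, D = 2); step 1 computes |L(e)| rather than listing the sets L(e). *)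

theory Defs
  imports
    "Graph_Theory.Arc_Walk"
    "HOL-Library.Landau_Symbols"
    "HOL-Library.Extended_Real"
    "HOL-Library.Monad_Syntax"
    "HOL-Library.While_Combinator"
begin

section \<open>The problem\<close>

text \<open>
  A tree rooted at \<open>s\<close> is a finite digraph with all edges directed away from \<open>s\<close>.  Edges are arcs
  of an abstract type, so that edge weights are functions on arcs.
\<close>

definition rooted_tree :: "('v, 'e) pre_digraph \<Rightarrow> 'v \<Rightarrow> bool" where
  "rooted_tree T s \<longleftrightarrow>
     fin_digraph T \<and> s \<in> verts T \<and> (\<forall>v\<in>verts T. \<exists>!p. pre_digraph.awalk T s p v)"

definition leaves :: "('v, 'e) pre_digraph \<Rightarrow> 'v set" where
  "leaves T = {t \<in> verts T. out_arcs T t = {}}"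

definition root_path :: "('v, 'e) pre_digraph \<Rightarrow> 'v \<Rightarrow> 'v \<Rightarrow> 'e list" where
  "root_path T s t = (THE p. pre_digraph.awalk T s p t)"

definition path_weight :: "('v, 'e) pre_digraph \<Rightarrow> 'v \<Rightarrow> ('e \<Rightarrow> real) \<Rightarrow> 'v \<Rightarrow> real" where
  "path_weight T s x t = (\<Sum>e\<in>set (root_path T s t). x e)"

definition root_leaf_distance_sum :: "('v, 'e) pre_digraph \<Rightarrow> 'v \<Rightarrow> ('e \<Rightarrow> real) \<Rightarrow> real" where
  "root_leaf_distance_sum T s x = (\<Sum>t\<in>leaves T. path_weight T s x t)"

definition hamming :: "real \<Rightarrow> real \<Rightarrow> real" where
  "hamming a b = (if a = b then 0 else 1)"

text \<open>The tree has at least one edge, so that the maximum in the objective is meaningful.\<close>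

definition mcsdipt_instance ::
  "('v, 'e) pre_digraph \<Rightarrow> 'v \<Rightarrow> ('e \<Rightarrow> real) \<Rightarrow> ('e \<Rightarrow> real) \<Rightarrow> ('e \<Rightarrow> real) \<Rightarrow> bool" where
  "mcsdipt_instance T s w u c \<longleftrightarrow>
     rooted_tree T s \<and> arcs T \<noteq> {} \<and> (\<forall>e\<in>arcs T. 0 \<le> w e \<and> w e \<le> u e \<and> 0 < c e)"

definition feasible ::
  "('v, 'e) pre_digraph \<Rightarrow> 'v \<Rightarrow> ('e \<Rightarrow> real) \<Rightarrow> ('e \<Rightarrow> real) \<Rightarrow> real \<Rightarrow> ('e \<Rightarrow> real) \<Rightarrow> bool" where
  "feasible T s w u D x \<longleftrightarrow>
     D \<le> root_leaf_distance_sum T s x \<and> (\<forall>e\<in>arcs T. w e \<le> x e \<and> x e \<le> u e)"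

definition objective ::
  "('v, 'e) pre_digraph \<Rightarrow> ('e \<Rightarrow> real) \<Rightarrow> ('e \<Rightarrow> real) \<Rightarrow> ('e \<Rightarrow> real) \<Rightarrow> real" where
  "objective T w c x = Max ((\<lambda>e. c e * hamming (x e) (w e)) ` arcs T)"

definition optimal ::
  "('v, 'e) pre_digraph \<Rightarrow> 'v \<Rightarrow> ('e \<Rightarrow> real) \<Rightarrow> ('e \<Rightarrow> real) \<Rightarrow> ('e \<Rightarrow> real) \<Rightarrow> real
     \<Rightarrow> ('e \<Rightarrow> real) \<Rightarrow> bool" where
  "optimal T s w u c D x \<longleftrightarrow>
     feasible T s w u D x \<and>
     (\<forall>y. feasible T s w u D y \<longrightarrow> objective T w c x \<le> objective T w c y)"

text \<open>
  An answer is a pair of a weight vector and its cost; the empty vector, reported with cost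
  \<open>\<infinity>\<close> for infeasible instances, is \<open>None\<close>.
\<close>

type_synonym 'e answer = "('e \<Rightarrow> real) option \<times> ereal"

definition solves ::
  "('v, 'e) pre_digraph \<Rightarrow> 'v \<Rightarrow> ('e \<Rightarrow> real) \<Rightarrow> ('e \<Rightarrow> real) \<Rightarrow> ('e \<Rightarrow> real) \<Rightarrow> real
     \<Rightarrow> 'e answer \<Rightarrow> bool" where
  "solves T s w u c D ans \<longleftrightarrow>
     (case ans of
        (None, C) \<Rightarrow> (\<nexists>y. feasible T s w u D y) \<and> C = \<infinity>
      | (Some x, C) \<Rightarrow> optimal T s w u c D x \<and> C = ereal (objective T w c x))"

section \<open>Computations with running time\<close>

text \<open>
  \<open>Halt x t\<close> is a computation that returns \<open>x\<close> after \<open>t\<close> units of time.  The time is that of a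
  unit-cost random access machine over the reals: one unit pays for a bounded number of arithmetic
  operations, comparisons, list constructions and deconstructions, and reads and writes of arrays.
  Arrays indexed by nodes or edges are functions; a write is a function update.
\<close>

datatype 'a run = Diverge | Halt 'a nat

definition charge :: "nat \<Rightarrow> 'a \<Rightarrow> 'a run" where
  "charge t x = Halt x t"

abbreviation step :: "'a \<Rightarrow> 'a run" where
  "step \<equiv> charge 1"

definition bind_run :: "'a run \<Rightarrow> ('a \<Rightarrow> 'b run) \<Rightarrow> 'b run" where
  "bind_run m f =
     (case m of
        Diverge \<Rightarrow> Diverge
      | Halt x t \<Rightarrow> (case f x of Diverge \<Rightarrow> Diverge | Halt y t' \<Rightarrow> Halt y (t + t')))"

adhoc_overloading Monad_Syntax.bind \<rightleftharpoons> bind_run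

primrec for_run :: "('x \<Rightarrow> 'a \<Rightarrow> 'a run) \<Rightarrow> 'x list \<Rightarrow> 'a \<Rightarrow> 'a run" where
  "for_run f [] a = step a"
| "for_run f (x # xs) a = do { a' \<leftarrow> step a; a'' \<leftarrow> f x a'; for_run f xs a'' }"

text \<open>Every evaluation of the guard takes one unit, including the last one.\<close>

definition while_run :: "('a \<Rightarrow> bool) \<Rightarrow> ('a \<Rightarrow> 'a run) \<Rightarrow> 'a \<Rightarrow> 'a run" where
  "while_run b f a =
     (case while_option
             (\<lambda>m. case m of Diverge \<Rightarrow> False | Halt x _ \<Rightarrow> b x)
             (\<lambda>m. do { x \<leftarrow> m; y \<leftarrow> f x; step y })
             (step a) of
        None \<Rightarrow> Diverge
      | Some m \<Rightarrow> m)"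

section \<open>The algorithm\<close>

text \<open>
  The tree is given by its root \<open>s\<close>, the list \<open>es\<close> of its edges, and the two end nodes \<open>src e\<close>
  (nearer to the root) and \<open>tgt e\<close> of every edge.
\<close>

definition child_edges :: "('e \<Rightarrow> 'v) \<Rightarrow> 'e list \<Rightarrow> ('v \<Rightarrow> 'e list) run" where
  "child_edges src es = do {
     adj \<leftarrow> charge (length es + 1) (\<lambda>_. []);
     for_run (\<lambda>e adj. step (adj(src e := e # adj (src e)))) es adj
   }"

text \<open>Lists the edges in an order in which every edge precedes all edges above it.\<close>

definition bottom_up :: "'v \<Rightarrow> ('e \<Rightarrow> 'v) \<Rightarrow> ('v \<Rightarrow> 'e list) \<Rightarrow> 'e list run" where
  "bottom_up s tgt adj = do {
     stack \<leftarrow> for_run (\<lambda>e st. step (e # st)) (adj s) [];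
     (stack, ord) \<leftarrow> while_run
       (\<lambda>(stack, ord). stack \<noteq> [])
       (\<lambda>(stack, ord). do {
          stack' \<leftarrow> for_run (\<lambda>e st. step (e # st)) (adj (tgt (hd stack))) (tl stack);
          step (stack', hd stack # ord) })
       (stack, []);
     step ord
   }"

text \<open>
  Returns \<open>|L(e)|\<close> for all edges \<open>e\<close>, the only information about the sets \<open>L(e)\<close> that is used later
  (their total size may be quadratic).  Here \<open>cnt v\<close> is the number of leaves in the part of the
  subtree at \<open>v\<close> visited so far.
\<close>

definition leaf_counts ::
  "('e \<Rightarrow> 'v) \<Rightarrow> ('e \<Rightarrow> 'v) \<Rightarrow> ('v \<Rightarrow> 'e list) \<Rightarrow> 'e list \<Rightarrow> ('e \<Rightarrow> nat) run" where
  "leaf_counts src tgt adj ord = do {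
     cnt \<leftarrow> charge (length ord + 1) (\<lambda>_. 0);
     l \<leftarrow> charge (length ord) (\<lambda>_. 0);
     (cnt, l) \<leftarrow> for_run (\<lambda>e (cnt, l). do {
         k \<leftarrow> step (if adj (tgt e) = [] then 1 else cnt (tgt e));
         step (cnt(src e := cnt (src e) + k), l(e := k)) }) ord (cnt, l);
     step l
   }"

definition sum_run :: "('e \<Rightarrow> real) \<Rightarrow> 'e list \<Rightarrow> real run" where
  "sum_run f es = for_run (\<lambda>e r. step (r + f e)) es 0"

fun merge_run :: "('e \<Rightarrow> real) \<Rightarrow> 'e list \<Rightarrow> 'e list \<Rightarrow> 'e list run" where
  "merge_run key [] ys = step ys"
| "merge_run key (x # xs) [] = step (x # xs)"
| "merge_run key (x # xs) (y # ys) =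
     (if key x \<le> key y
      then do { zs \<leftarrow> merge_run key xs (y # ys); step (x # zs) }
      else do { zs \<leftarrow> merge_run key (x # xs) ys; step (y # zs) })"

fun sort_run :: "('e \<Rightarrow> real) \<Rightarrow> 'e list \<Rightarrow> 'e list run" where
  "sort_run key xs =
     (if length xs \<le> 1 then step xs
      else do {
        xs' \<leftarrow> charge (length xs) xs;
        ys \<leftarrow> sort_run key (take (length xs div 2) xs);
        zs \<leftarrow> sort_run key (drop (length xs div 2) xs);
        merge_run key ys zs })"

declare sort_run.simps [simp del]

text \<open>
  The prefix sums \<open>g(k)\<close> and \<open>g(k+1)\<close> are recomputed in every iteration.  The interval
  searched is initially \<open>[start, n]\<close>.
\<close>

definition search :: "nat \<Rightarrow> nat \<Rightarrow> ('e \<Rightarrow> real) \<Rightarrow> 'e list \<Rightarrow> real \<Rightarrow> nat run" where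
  "search start n S \<alpha> \<Delta> = do {
     (a, b, k\<^sub>0) \<leftarrow> while_run
       (\<lambda>(a, b, k\<^sub>0). b - a > 1 \<and> k\<^sub>0 = 0)
       (\<lambda>(a, b, k\<^sub>0). do {
          k \<leftarrow> step ((a + b) div 2);
          g \<leftarrow> sum_run S (take k \<alpha>);
          g' \<leftarrow> sum_run S (take (k + 1) \<alpha>);
          step (if g < \<Delta> \<and> \<Delta> \<le> g' then (a, b, k)
                else if g' < \<Delta> then (k, b, k\<^sub>0)
                else (a, k, k\<^sub>0)) })
       (start, n, 0);
     step k\<^sub>0
   }"

definition algorithm_A_from ::
  "nat \<Rightarrow> 'v \<Rightarrow> 'e list \<Rightarrow> ('e \<Rightarrow> 'v) \<Rightarrow> ('e \<Rightarrow> 'v) \<Rightarrow> nat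
     \<Rightarrow> ('e \<Rightarrow> real) \<Rightarrow> ('e \<Rightarrow> real) \<Rightarrow> ('e \<Rightarrow> real) \<Rightarrow> real \<Rightarrow> 'e answer run" where
  "algorithm_A_from start s es src tgt n w u c D = do {
     adj \<leftarrow> child_edges src es;
     ord \<leftarrow> bottom_up s tgt adj;
     l \<leftarrow> leaf_counts src tgt adj ord;
     F \<leftarrow> charge n (\<lambda>_. 0);
     F \<leftarrow> for_run (\<lambda>e F. step (F(e := c e * (u e - w e)))) es F;
     wT \<leftarrow> sum_run (\<lambda>e. real (l e) * w e) es;
     \<Delta> \<leftarrow> step (D - wT);
     uT \<leftarrow> sum_run (\<lambda>e. real (l e) * u e) es;
     if uT < D then step (None, \<infinity>)
     else if wT \<ge> D then step (Some w, 0)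
     else do {
       \<alpha> \<leftarrow> sort_run c es;
       k \<leftarrow> search start n (\<lambda>e. real (l e) * (u e - w e)) \<alpha> \<Delta>;
       x \<leftarrow> charge n w;
       x \<leftarrow> for_run (\<lambda>e x. step (x(e := u e))) (take (k + 1) \<alpha>) x;
       C \<leftarrow> charge (k + 1) (c (\<alpha> ! k));
       step (Some x, ereal C)
     }
   }"

text \<open>
  The search starts at \<open>a = 0\<close>.  Started at \<open>a = 1\<close>, the loop only inspects indices \<open>k \<ge> 2\<close>; hence
  it misses the case \<open>g(1) < \<Delta>D \<le> g(2)\<close>, and the weight vector that it then returns is infeasible.
\<close>

definition algorithm_A ::
  "'v \<Rightarrow> 'e list \<Rightarrow> ('e \<Rightarrow> 'v) \<Rightarrow> ('e \<Rightarrow> 'v) \<Rightarrow> nat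
     \<Rightarrow> ('e \<Rightarrow> real) \<Rightarrow> ('e \<Rightarrow> real) \<Rightarrow> ('e \<Rightarrow> real) \<Rightarrow> real \<Rightarrow> 'e answer run" where
  "algorithm_A = algorithm_A_from 0"

lemma start_1_infeasible:
  fixes T :: "(nat, nat) pre_digraph" and w u c :: "nat \<Rightarrow> real"
  defines "T \<equiv> \<lparr>verts = {0, 1, 2}, arcs = {1, 2}, tail = (\<lambda>_. 0), head = (\<lambda>e. e)\<rparr>"
    and "w \<equiv> (\<lambda>_. 0)" and "u \<equiv> (\<lambda>_. 1)" and "c \<equiv> (\<lambda>_. 1)"
  shows "mcsdipt_instance T 0 w u c" and "feasible T 0 w u 2 u"
    and "\<exists>x C t. algorithm_A_from 1 0 [1, 2] (tail T) (head T) 2 w u c 2 = Halt (Some x, C) t \<and>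
                 \<not> feasible T 0 w u 2 x"
proof -
  interpret fin_digraph T
    by unfold_locales (auto simp: T_def)
  have T: "verts T = {0, 1, 2}" "arcs T = {1, 2}" "tail T = (\<lambda>_. 0)" "head T = (\<lambda>e. e)"
    by (simp_all add: T_def)
  have walk: "awalk 0 p v \<longleftrightarrow> p = [] \<and> v = 0 \<or> p = [v] \<and> (v = 1 \<or> v = 2)" for p v
  proof (cases p)
    case Nil
    then show ?thesis by (auto simp: awalk_def T)
  next
    case (Cons e q)
    then show ?thesis by (cases q) (auto simp: awalk_def T)
  qed
  have "rooted_tree T 0"
    unfolding rooted_tree_def walk by (auto simp: fin_digraph_axioms T)
  then show "mcsdipt_instance T 0 w u c"
    by (auto simp: mcsdipt_instance_def w_def u_def c_def T)
  have leaves: "leaves T = {1, 2}"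
    by (auto simp: leaves_def out_arcs_def T)
  have path: "root_path T 0 1 = [1]" "root_path T 0 2 = [2]"
    by (simp_all add: root_path_def walk)
  have total: "root_leaf_distance_sum T 0 x = x 1 + x 2" for x
    by (simp add: root_leaf_distance_sum_def leaves path_weight_def path del: One_nat_def)
  show "feasible T 0 w u 2 u"
    by (simp add: feasible_def total) (simp add: u_def w_def)
  have "case algorithm_A_from 1 0 [1, 2] (\<lambda>_. 0 :: nat) (\<lambda>e. e) 2 (\<lambda>_. 0) (\<lambda>_. 1) (\<lambda>_. 1) 2 of
          Halt (Some x, C) t \<Rightarrow> x 1 + x 2 = 1 | _ \<Rightarrow> False"
    by code_simp
  then have "\<exists>x C t. algorithm_A_from 1 0 [1, 2] (tail T) (head T) 2 w u c 2 = Halt (Some x, C) t \<and>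
          x 1 + x 2 = 1"
    by (auto simp: T w_def u_def c_def split: run.splits prod.splits option.splits)
  then show "\<exists>x C t. algorithm_A_from 1 0 [1, 2] (tail T) (head T) 2 w u c 2 = Halt (Some x, C) t \<and>
               \<not> feasible T 0 w u 2 x"
    by (fastforce simp: feasible_def total)
qed

end

theory Submission
  imports Defs "HOL-Library.Log_Nat" "HOL-Library.Multiset" "HOL-Real_Asymp.Real_Asymp"
begin

text \<open>
  Exchanging summations, \<open>x(T)\<close> is the sum of \<open>|L(e)| x(e)\<close> over all edges, so raising the
  edges of a set \<open>P\<close> to their upper bounds gains the sum of \<open>S(e)\<close> over \<open>P\<close>.  A vector of cost
  less than \<open>c(\<alpha>\<^sub>k\<^sub>+\<^sub>1)\<close> changes only edges among the first \<open>k\<close> in the order of costs, hence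
  gains at most \<open>g(k)\<close>; so the optimum is \<open>c(\<alpha>\<^sub>k\<^sub>+\<^sub>1)\<close> for the \<open>k\<close> with
  \<open>g(k) < \<Delta>D \<le> g(k + 1)\<close>.  The search makes at most \<open>\<lceil>log n\<rceil>\<close> iterations of linear cost, and
  the rest except for the sorting is linear.
\<close>

section \<open>Reasoning about running time\<close>

text \<open>This is total correctness: \<open>Diverge\<close> never qualifies. The time is only
  bounded from above, so bounds can be rounded up when computations are composed.\<close>

definition halts_within :: "'a run \<Rightarrow> nat \<Rightarrow> ('a \<Rightarrow> bool) \<Rightarrow> bool" where
  "halts_within m t Q \<longleftrightarrow> (\<exists>x t'. m = Halt x t' \<and> t' \<le> t \<and> Q x)"

lemma bind_Halt [simp]:
  "bind_run (Halt x t) f = (case f x of Diverge \<Rightarrow> Diverge | Halt y t' \<Rightarrow> Halt y (t + t'))"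
  by (simp add: bind_run_def)

lemma halts_within_Halt [simp]: "halts_within (Halt x t') t Q \<longleftrightarrow> t' \<le> t \<and> Q x"
  by (auto simp: halts_within_def)

lemma halts_within_charge [simp]: "halts_within (charge t' x) t Q \<longleftrightarrow> t' \<le> t \<and> Q x"
  by (simp add: charge_def)

lemma halts_withinE:
  assumes "halts_within m t Q"
  obtains x t' where "m = Halt x t'" "t' \<le> t" "Q x"
  using assms by (auto simp: halts_within_def)

lemma halts_within_mono:
  assumes "halts_within m t P" "t \<le> t'" "\<And>x. P x \<Longrightarrow> Q x"
  shows "halts_within m t' Q"
  using assms by (fastforce simp: halts_within_def)

lemma halts_within_bind:
  assumes "halts_within m t P" "\<And>x. P x \<Longrightarrow> halts_within (f x) t' Q" "t + t' \<le> t''"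
  shows "halts_within (bind_run m f) t'' Q"
  using assms by (fastforce elim!: halts_withinE)

text \<open>For computations known in closed form: the exact result is passed on to \<open>f\<close>
  instead of a mere property of it.\<close>

lemma halts_within_bind_Halt:
  assumes "m = Halt x t" "halts_within (f x) t' Q" "t + t' \<le> t''"
  shows "halts_within (bind_run m f) t'' Q"
  using assms by (intro halts_within_bind[of _ t "\<lambda>y. y = x"]) auto

lemma for_run_eq_fold:
  assumes "\<And>x a. f x a = Halt (g x a) k"
  shows "for_run f xs a = Halt (fold g xs a) ((k + 1) * length xs + 1)"
  by (induction xs arbitrary: a) (simp_all add: charge_def assms)

text \<open>Potential method: the drop of \<open>\<phi>\<close> in an iteration pays for the body
  and the next evaluation of the guard. As \<open>t\<close> may depend on the state, expensive
  iterations can be paid for by cheap ones. The extra unit of the bound is the first guard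
  evaluation.\<close>

lemma while_halts_within:
  fixes \<phi> :: "'a \<Rightarrow> nat"
  assumes "I a"
    and step: "\<And>x. I x \<Longrightarrow> b x \<Longrightarrow> \<exists>t. halts_within (f x) t (\<lambda>y. I y \<and> \<phi> y + t + 1 \<le> \<phi> x)"
  shows "halts_within (while_run b f a) (\<phi> a + 1) (\<lambda>x. I x \<and> \<not> b x)"
proof -
  let ?b = "\<lambda>m. case m of Diverge \<Rightarrow> False | Halt x _ \<Rightarrow> b x"
  let ?c = "\<lambda>m. bind_run m (\<lambda>x. bind_run (f x) (\<lambda>y. Defs.step y))"
  \<comment> \<open>The state of \<open>while_option\<close> carries the time \<open>r\<close> spent
    so far. It has to be arbitrary in the induction on the potential.\<close>
  have "\<exists>y t. while_option ?b ?c (Halt x r) = Some (Halt y t) \<and> t \<le> r + \<phi> x \<and> I y \<and> \<not> b y"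
    if "I x" for x r
    using that
  proof (induction "\<phi> x" arbitrary: x r rule: less_induct)
    case less
    show ?case
    proof (cases "b x")
      case True
      obtain y t t' where y: "f x = Halt y t'" "t' \<le> t" "I y" "\<phi> y + t + 1 \<le> \<phi> x"
        using step[OF less.prems True] by (auto elim!: halts_withinE)
      then have "?c (Halt x r) = Halt y (r + (t' + 1))"
        by (simp add: charge_def)
      moreover obtain z t'' where "while_option ?b ?c (Halt y (r + (t' + 1))) = Some (Halt z t'')"
          "t'' \<le> r + (t' + 1) + \<phi> y" "I z" "\<not> b z"
        using less.hyps[of y "r + (t' + 1)"] y by auto
      ultimately show ?thesis
        using True y by (subst while_option_unfold) auto
    qed (use less.prems in \<open>simp add: while_option_unfold\<close>)
  qed
  from this[OF \<open>I a\<close>, of 1] show ?thesis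
    by (auto simp: while_run_def charge_def)
qed

section \<open>Exact results and times of the elementary loops\<close>

lemma sum_run_eq: "sum_run f xs = Halt (sum_list (map f xs)) (2 * length xs + 1)"
proof -
  have "fold (\<lambda>e r. r + f e) xs r = r + sum_list (map f xs)" for r
    by (induction xs arbitrary: r) simp_all
  then show ?thesis
    unfolding sum_run_def
    by (subst for_run_eq_fold[where g = "\<lambda>e r. r + f e" and k = 1]) (simp_all add: charge_def)
qed

lemma for_run_update_eq:
  "for_run (\<lambda>e x. step (x(e := f e))) xs x =
     Halt (\<lambda>e. if e \<in> set xs then f e else x e) (2 * length xs + 1)"
proof -
  have "fold (\<lambda>e x. x(e := f e)) xs x = (\<lambda>e. if e \<in> set xs then f e else x e)"
    by (induction xs arbitrary: x) (auto simp: fun_eq_iff)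
  then show ?thesis
    by (subst for_run_eq_fold[where g = "\<lambda>e x. x(e := f e)" and k = 1])
      (simp_all add: charge_def)
qed

lemma for_run_push_eq:
  "for_run (\<lambda>e st. step (e # st)) xs st = Halt (rev xs @ st) (2 * length xs + 1)"
  by (subst for_run_eq_fold[where g = Cons and k = 1])
    (simp_all add: charge_def fold_Cons_rev)

lemma child_edges_eq:
  "child_edges src es = Halt (\<lambda>v. rev (filter (\<lambda>e. src e = v) es)) (3 * length es + 2)"
proof -
  have "fold (\<lambda>e adj. adj(src e := e # adj (src e))) es adj =
      (\<lambda>v. rev (filter (\<lambda>e. src e = v) es) @ adj v)" for adj :: "'a \<Rightarrow> 'b list"
    by (induction es arbitrary: adj) (auto simp: fun_eq_iff)
  then have "for_run (\<lambda>e adj. step (adj(src e := e # adj (src e)))) es (\<lambda>_. []) =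
      Halt (\<lambda>v. rev (filter (\<lambda>e. src e = v) es)) (2 * length es + 1)"
    by (subst for_run_eq_fold[where g = "\<lambda>e adj. adj(src e := e # adj (src e))" and k = 1])
      (simp_all add: charge_def)
  then show ?thesis
    by (simp add: child_edges_def charge_def)
qed

section \<open>Merge sort\<close>

lemma merge_run_halts:
  assumes "sorted (map key xs)" "sorted (map key ys)"
  shows "halts_within (merge_run key xs ys) (length xs + length ys + 1)
    (\<lambda>zs. mset zs = mset xs + mset ys \<and> sorted (map key zs))"
  using assms
proof (induction key xs ys rule: merge_run.induct)
  case (3 key x xs y ys)
  \<comment> \<open>Shared by both branches: the recursive result has the elements of the two
    remaining lists, so an element with a key at most theirs may go in front.\<close>
  have prepend: "mset (z # zs) = add_mset z (mset xs' + mset ys') \<and> sorted (map key (z # zs))"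
    if "mset zs = mset xs' + mset ys' \<and> sorted (map key zs)" "\<forall>z'\<in>set xs' \<union> set ys'. key z \<le> key z'"
    for z zs xs' ys'
  proof -
    have "set zs = set xs' \<union> set ys'"
      using that by (metis set_mset_mset set_mset_union)
    then show ?thesis
      using that by simp
  qed
  show ?case
  proof (cases "key x \<le> key y")
    case True
    have "halts_within (merge_run key xs (y # ys)) (length xs + length (y # ys) + 1)
        (\<lambda>zs. mset zs = mset xs + mset (y # ys) \<and> sorted (map key zs))"
      using 3 True by simp
    then have "halts_within (bind_run (merge_run key xs (y # ys)) (\<lambda>zs. step (x # zs)))
        (length (x # xs) + length (y # ys) + 1)
        (\<lambda>zs. mset zs = mset (x # xs) + mset (y # ys) \<and> sorted (map key zs))"
      by (rule halts_within_bind[where t' = 1])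
        (use 3 True prepend[of _ xs "y # ys" x] in \<open>force+\<close>)
    then show ?thesis using True by simp
  next
    case False
    have "halts_within (merge_run key (x # xs) ys) (length (x # xs) + length ys + 1)
        (\<lambda>zs. mset zs = mset (x # xs) + mset ys \<and> sorted (map key zs))"
      using 3 False by simp
    then have "halts_within (bind_run (merge_run key (x # xs) ys) (\<lambda>zs. step (y # zs)))
        (length (x # xs) + length (y # ys) + 1)
        (\<lambda>zs. mset zs = mset (x # xs) + mset (y # ys) \<and> sorted (map key zs))"
      by (rule halts_within_bind[where t' = 1])
        (use 3 False prepend[of _ "x # xs" ys y] in \<open>force+\<close>)
    then show ?thesis using False by simp
  qed
qed auto

text \<open>Halving the list lowers \<open>ceillog2\<close> by one, and splitting and merging cost
  \<open>2 * n + 1\<close>, which is at most \<open>3 * n\<close> per level. The linear term pays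
  for the lists of length 1; for the empty list the bound would be 0.\<close>

lemma sort_run_halts:
  assumes "xs \<noteq> []"
  shows "halts_within (sort_run key xs) (3 * length xs * ceillog2 (length xs) + length xs)
    (\<lambda>ys. mset ys = mset xs \<and> sorted (map key ys))"
  using assms
proof (induction key xs rule: sort_run.induct)
  case (1 key xs)
  show ?case
  proof (cases "length xs \<le> 1")
    case True
    then show ?thesis
      using 1 by (cases xs) (simp_all add: sort_run.simps charge_def)
  next
    case False
    define n m where "n = length xs" and "m = length xs div 2"
    define L where "L = ceillog2 ((n + 1) div 2)"
    have n: "n \<ge> 2" "m \<ge> 1" "m \<le> n" "n - m = (n + 1) div 2" "n - m \<ge> 1"
      using False by (auto simp: n_def m_def)
    have L: "ceillog2 n = L + 1" "ceillog2 m \<le> L" "ceillog2 (n - m) = L"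
      unfolding L_def n using n ceillog2_rec[of n] by (auto intro!: ceillog2_mono simp: m_def n_def)
    \<comment> \<open>Here \<open>i\<close> and \<open>j\<close> are the lengths of the halves. The
      shorter half may have the smaller logarithm \<open>p\<close>; writing \<open>L = p + d\<close>
      makes the products comparable, and \<open>1 \<le> i\<close> absorbs the final unit of the
      merge.\<close>
    have "(i + j) + ((3 * i * p + i) + ((3 * j * L + j) + ((i + j) + 1)))
        \<le> 3 * (i + j) * (L + 1) + (i + j)" if p: "p \<le> L" and i: "1 \<le> i" for i j p
    proof -
      obtain d where "L = p + d"
        using le_Suc_ex[OF p] by blast
      then show ?thesis
        using i by (simp add: algebra_simps)
    qed
    from this[of "ceillog2 m" m "n - m"]
    have bound: "n + ((3 * m * ceillog2 m + m) + ((3 * (n - m) * ceillog2 (n - m) + (n - m)) + (n + 1)))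
        \<le> 3 * n * ceillog2 n + n"
      using n(2,3) L by simp
    have take: "halts_within (sort_run key (take m xs)) (3 * m * ceillog2 m + m)
        (\<lambda>ys. mset ys = mset (take m xs) \<and> sorted (map key ys))"
      using 1(1)[OF False, folded m_def] 1(3) n by (simp add: n_def min_absorb2)
    have drop: "halts_within (sort_run key (drop m xs)) (3 * (n - m) * ceillog2 (n - m) + (n - m))
        (\<lambda>ys. mset ys = mset (drop m xs) \<and> sorted (map key ys))"
      using 1(2)[OF False, folded m_def] n(5) by (simp add: n_def)
    have "halts_within
        (bind_run (charge n xs) (\<lambda>xs'. bind_run (sort_run key (take m xs))
          (\<lambda>ys. bind_run (sort_run key (drop m xs)) (merge_run key ys))))
        (3 * n * ceillog2 n + n) (\<lambda>ys. mset ys = mset xs \<and> sorted (map key ys))"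
    proof (rule halts_within_bind[OF _ _ bound])
      fix xs'
      show "halts_within (bind_run (sort_run key (take m xs))
          (\<lambda>ys. bind_run (sort_run key (drop m xs)) (merge_run key ys)))
        ((3 * m * ceillog2 m + m) + ((3 * (n - m) * ceillog2 (n - m) + (n - m)) + (n + 1)))
        (\<lambda>ys. mset ys = mset xs \<and> sorted (map key ys))"
      proof (rule halts_within_bind[OF take _ order.refl])
        fix ys assume ys: "mset ys = mset (take m xs) \<and> sorted (map key ys)"
        show "halts_within (bind_run (sort_run key (drop m xs)) (merge_run key ys))
          ((3 * (n - m) * ceillog2 (n - m) + (n - m)) + (n + 1))
          (\<lambda>ys. mset ys = mset xs \<and> sorted (map key ys))"
        proof (rule halts_within_bind[OF drop _ order.refl])
          fix zs assume zs: "mset zs = mset (drop m xs) \<and> sorted (map key zs)"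
          have "length ys = m" "length zs = n - m"
            using ys zs n by (auto dest!: mset_eq_length simp: n_def m_def)
          moreover have "mset ys + mset zs = mset xs"
            using ys zs by (metis append_take_drop_id mset_append)
          ultimately show "halts_within (merge_run key ys zs) (n + 1)
              (\<lambda>ys. mset ys = mset xs \<and> sorted (map key ys))"
            using ys zs n by (intro halts_within_mono[OF merge_run_halts]) auto
        qed
      qed
    qed simp
    then show ?thesis
      using False by (simp add: sort_run.simps[of key xs] n_def m_def charge_def)
  qed
qed

section \<open>Binary search\<close>

text \<open>
  The invariant \<open>a = 0 \<or> g (a + 1) < \<Delta>\<close> together with \<open>\<Delta> \<le> g b\<close> leaves only \<open>[0, 1]\<close> as an
  interval of length 1, so the default answer 0 is correct if the loop ends without success.
\<close>

lemma search_halts: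
  fixes S :: "'e \<Rightarrow> real"
  defines "g \<equiv> \<lambda>k \<alpha>. sum_list (map S (take k \<alpha>))"
  assumes "0 < \<Delta>" "\<Delta> \<le> g (length \<alpha>) \<alpha>"
  shows "halts_within (search 0 (length \<alpha>) S \<alpha> \<Delta>)
    ((4 * length \<alpha> + 5) * ceillog2 (length \<alpha>) + 2)
    (\<lambda>k. k < length \<alpha> \<and> g k \<alpha> < \<Delta> \<and> \<Delta> \<le> g (k + 1) \<alpha>)"
proof -
  let ?n = "length \<alpha>"
  \<comment> \<open>Only indices \<open>k > 0\<close> are ever inspected, so \<open>k = 0\<close>
    can safely encode that the search has not succeeded yet.\<close>
  define I where "I = (\<lambda>(a, b, k).
    if k = 0 then a < b \<and> b \<le> ?n \<and> \<Delta> \<le> g b \<alpha> \<and> (a = 0 \<or> g (a + 1) \<alpha> < \<Delta>)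
    else k < ?n \<and> g k \<alpha> < \<Delta> \<and> \<Delta> \<le> g (k + 1) \<alpha>)"
  \<comment> \<open>An iteration costs at most \<open>4 * ?n + 4\<close>, mostly for two prefix
    sums, and the guard adds 1. Success ends the loop, hence the potential 0.\<close>
  define \<phi> where "\<phi> = (\<lambda>(a :: nat, b, k :: nat). if k = 0 then (4 * ?n + 5) * ceillog2 (b - a) else (0 :: nat))"
  have "?n > 0"
    using assms by (cases \<alpha>) (auto simp: g_def)
  then have init: "I (0, ?n, 0)"
    using assms by (simp add: I_def)
  show ?thesis
    unfolding search_def
  proof (rule halts_within_bind[OF while_halts_within[where I = I and \<phi> = \<phi>]])
    fix st assume st: "I st" "case st of (a, b, k\<^sub>0) \<Rightarrow> b - a > 1 \<and> k\<^sub>0 = 0"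
    obtain a b where [simp]: "st = (a, b, 0)"
      using st by (cases st) auto
    define k where "k = (a + b) div 2"
    have k: "0 < k" "a < k" "k < b" "b \<le> ?n"
      using st by (auto simp: k_def I_def)
    have half: "k - a \<le> (b - a + 1) div 2" "b - k \<le> (b - a + 1) div 2"
      using k by (auto simp: k_def)
    have rec: "ceillog2 (b - a) = 1 + ceillog2 ((b - a + 1) div 2)"
      using st by (subst ceillog2_rec) auto
    have "(4 * ?n + 5) * ceillog2 d + (4 * ?n + 5) \<le> (4 * ?n + 5) * ceillog2 (b - a)"
      if "d \<le> (b - a + 1) div 2" for d
    proof -
      have "(4 * ?n + 5) * (ceillog2 d + 1) \<le> (4 * ?n + 5) * ceillog2 (b - a)"
        unfolding rec using ceillog2_mono[OF that] by (intro mult_le_mono) auto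
      then show ?thesis by simp
    qed
    \<comment> \<open>The instances belong to \<open>b := k\<close>, \<open>a := k\<close> and
      success, in this order; the last one uses \<open>ceillog2 0 = 0\<close>.\<close>
    note dec = this[OF half(1)] this[OF half(2)] this[of 0]
    show "\<exists>t. halts_within (case st of (a, b, k\<^sub>0) \<Rightarrow> do {
          k \<leftarrow> step ((a + b) div 2);
          g \<leftarrow> sum_run S (take k \<alpha>);
          g' \<leftarrow> sum_run S (take (k + 1) \<alpha>);
          step (if g < \<Delta> \<and> \<Delta> \<le> g' then (a, b, k)
                else if g' < \<Delta> then (k, b, k\<^sub>0)
                else (a, k, k\<^sub>0)) }) t (\<lambda>y. I y \<and> \<phi> y + t + 1 \<le> \<phi> st)"
    proof
      show "halts_within (case st of (a, b, k\<^sub>0) \<Rightarrow> do {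
          k \<leftarrow> step ((a + b) div 2);
          g \<leftarrow> sum_run S (take k \<alpha>);
          g' \<leftarrow> sum_run S (take (k + 1) \<alpha>);
          step (if g < \<Delta> \<and> \<Delta> \<le> g' then (a, b, k)
                else if g' < \<Delta> then (k, b, k\<^sub>0)
                else (a, k, k\<^sub>0)) }) (4 * ?n + 4) (\<lambda>y. I y \<and> \<phi> y + (4 * ?n + 4) + 1 \<le> \<phi> st)"
        \<comment> \<open>If both tests fail, then \<open>\<Delta> \<le> g (k + 1)\<close>, so the
          first one failed because of \<open>\<Delta> \<le> g k\<close>. This is the invariant for
          the new right end.\<close>
        using k dec st
        by (simp add: sum_run_eq charge_def flip: k_def) (auto simp: I_def \<phi>_def g_def)
    qed
  next
    fix st assume "I st \<and> \<not> (case st of (a, b, k\<^sub>0) \<Rightarrow> b - a > 1 \<and> k\<^sub>0 = 0)"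
    moreover obtain a b k where [simp]: "st = (a, b, k)"
      by (cases st)
    ultimately have I: "I (a, b, k)" "k = 0 \<longrightarrow> b - a \<le> 1"
      by auto
    have "k < ?n \<and> g k \<alpha> < \<Delta> \<and> \<Delta> \<le> g (k + 1) \<alpha>"
    proof (cases "k = 0")
      case True
      then have "b = a + 1"
        using I by (auto simp: I_def)
      then show ?thesis
        using I True assms by (auto simp: I_def)
    qed (use I in \<open>auto simp: I_def\<close>)
    then show "halts_within (case st of (a, b, k\<^sub>0) \<Rightarrow> step k\<^sub>0) 1
        (\<lambda>k. k < ?n \<and> g k \<alpha> < \<Delta> \<and> \<Delta> \<le> g (k + 1) \<alpha>)"
      by simp
  qed (use init in \<open>auto simp: \<phi>_def\<close>)
qed

section \<open>Rooted trees\<close>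

locale rooted_digraph = fin_digraph T for T :: "('v, 'e) pre_digraph" +
  fixes s :: 'v
  assumes root: "s \<in> verts T"
    and unique_path: "v \<in> verts T \<Longrightarrow> \<exists>!p. awalk s p v"
begin

text \<open>This is the set \<open>L(e)\<close> of the problem.\<close>

definition leaves_below :: "'e \<Rightarrow> 'v set" where
  "leaves_below e = {t \<in> leaves T. e \<in> set (root_path T s t)}"

lemma root_path_eqI: "awalk s p v \<Longrightarrow> root_path T s v = p"
  unfolding root_path_def using unique_path[of v] awalk_last_in_verts[of s p v]
  by (intro the1_equality) auto

lemma awalk_root_path: "v \<in> verts T \<Longrightarrow> awalk s (root_path T s v) v"
  unfolding root_path_def by (rule theI') (rule unique_path)

text \<open>Appending the arc to the path to its tail gives a walk, and walks from the root are
  unique. Comparing such paths then excludes arcs into the root, loops, and two arcs with the same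
  head.\<close>

lemma root_path_head:
  assumes "e \<in> arcs T"
  shows "root_path T s (head T e) = root_path T s (tail T e) @ [e]"
  using assms awalk_root_path[of "tail T e"]
  by (intro root_path_eqI) (auto intro: awalk_appendI arc_implies_awalk)

lemma root_path_root: "root_path T s s = []"
  by (rule root_path_eqI) (simp add: awalk_Nil_iff root)

lemma head_neq_root: "e \<in> arcs T \<Longrightarrow> head T e \<noteq> s"
  using root_path_head root_path_root by force

lemma head_eq_iff: "e \<in> arcs T \<Longrightarrow> e' \<in> arcs T \<Longrightarrow> head T e = head T e' \<longleftrightarrow> e = e'"
  using root_path_head by (metis last_snoc)

lemma tail_neq_head: "e \<in> arcs T \<Longrightarrow> tail T e \<noteq> head T e"
  using root_path_head by force

text \<open>The part of the path before \<open>e\<close> is a walk from the root to the tail of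
  \<open>e\<close>, hence the root path of that tail.\<close>

lemma root_path_split:
  assumes "t \<in> verts T" "e \<in> set (root_path T s t)"
  obtains q where "e \<in> arcs T" "root_path T s t = root_path T s (tail T e) @ e # q"
    "awalk (head T e) q t"
proof -
  obtain p q where pq: "root_path T s t = p @ e # q"
    using assms by (meson split_list)
  then have *: "awalk s p (awlast s p)" "awalk (awlast s p) (e # q) t"
    using awalk_root_path[OF assms(1)] by auto
  then have "awlast s p = tail T e" "e \<in> arcs T" "awalk (head T e) q t"
    by (auto simp: awalk_Cons_iff)
  with * pq show thesis
    by (metis root_path_eqI that)
qed

section \<open>Recursion for the number of leaves below an edge\<close>

lemma leaves_below_leaf:
  assumes "e \<in> arcs T" "out_arcs T (head T e) = {}"
  shows "leaves_below e = {head T e}"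
proof
  show "{head T e} \<subseteq> leaves_below e"
    using assms by (auto simp: leaves_below_def leaves_def root_path_head)
  show "leaves_below e \<subseteq> {head T e}"
  proof
    fix t assume "t \<in> leaves_below e"
    then obtain q where "awalk (head T e) q t"
      by (auto simp: leaves_below_def leaves_def elim: root_path_split)
    then show "t \<in> {head T e}"
      using assms(2) by (cases q) (auto simp: awalk_simps out_arcs_def)
  qed
qed

text \<open>The head of \<open>e\<close> is not a leaf, so a root path through \<open>e\<close> to a
  leaf continues with a child edge. Conversely, a root path through a child edge starts with the
  root path to the head of \<open>e\<close>, which ends in \<open>e\<close>.\<close>

lemma leaves_below_inner:
  assumes "e \<in> arcs T" "out_arcs T (head T e) \<noteq> {}"
  shows "leaves_below e = (\<Union>e'\<in>out_arcs T (head T e). leaves_below e')"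
proof (intro equalityI subsetI)
  fix t assume t: "t \<in> leaves_below e"
  then obtain q where q: "root_path T s t = root_path T s (tail T e) @ e # q" "awalk (head T e) q t"
    by (auto simp: leaves_below_def leaves_def elim: root_path_split)
  have "q \<noteq> []"
    using q t assms by (auto simp: leaves_below_def leaves_def awalk_simps)
  then obtain e' q' where "q = e' # q'"
    by (cases q) auto
  then show "t \<in> (\<Union>e'\<in>out_arcs T (head T e). leaves_below e')"
    using q t by (auto simp: leaves_below_def awalk_simps out_arcs_def intro!: bexI[of _ e'])
next
  fix t assume "t \<in> (\<Union>e'\<in>out_arcs T (head T e). leaves_below e')"
  then obtain e' where e': "tail T e' = head T e" "t \<in> leaves T" "e' \<in> set (root_path T s t)"
    by (auto simp: leaves_below_def out_arcs_def)
  then obtain q where "root_path T s t = root_path T s (tail T e') @ e' # q"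
    by (auto simp: leaves_def elim: root_path_split)
  then show "t \<in> leaves_below e"
    using e' assms by (simp add: leaves_below_def root_path_head)
qed

text \<open>A root path containing both edges would have the same prefix before each of them, hence
  the same next edge.\<close>

lemma leaves_below_disjoint:
  assumes "tail T e = tail T e'" "e \<noteq> e'"
  shows "leaves_below e \<inter> leaves_below e' = {}"
proof -
  have "e = e'" if "t \<in> verts T" "e \<in> set (root_path T s t)" "e' \<in> set (root_path T s t)" for t
    using root_path_split[OF that(1,2)] root_path_split[OF that(1,3)] assms(1)
    by (metis list.inject same_append_eq)
  then show ?thesis
    using assms by (auto simp: leaves_below_def leaves_def)
qed

lemma finite_leaves: "finite (leaves T)"
  by (simp add: leaves_def)

lemma card_leaves_below:
  assumes "e \<in> arcs T"
  shows "card (leaves_below e) = (if out_arcs T (head T e) = {} then 1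
    else \<Sum>e'\<in>out_arcs T (head T e). card (leaves_below e'))"
proof (cases "out_arcs T (head T e) = {}")
  case False
  have "card (\<Union>e'\<in>out_arcs T (head T e). leaves_below e') =
      (\<Sum>e'\<in>out_arcs T (head T e). card (leaves_below e'))"
    by (intro card_UN_disjoint ballI impI leaves_below_disjoint)
      (auto simp: leaves_below_def finite_leaves)
  then show ?thesis
    using False assms by (simp add: leaves_below_inner)
qed (simp add: assms leaves_below_leaf)

lemma root_leaf_distance_sum_eq:
  "root_leaf_distance_sum T s x = (\<Sum>e\<in>arcs T. real (card (leaves_below e)) * x e)"
proof -
  have "set (root_path T s t) = {e \<in> arcs T. e \<in> set (root_path T s t)}" if "t \<in> leaves T" for t
    using that awalk_root_path[of t] by (auto simp: leaves_def awalk_def)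
  then have "root_leaf_distance_sum T s x =
      (\<Sum>t\<in>leaves T. \<Sum>e | e \<in> arcs T \<and> e \<in> set (root_path T s t). x e)"
    by (simp add: root_leaf_distance_sum_def path_weight_def)
  also have "\<dots> = (\<Sum>e\<in>arcs T. \<Sum>t\<in>leaves_below e. x e)"
    unfolding leaves_below_def by (rule sum.swap_restrict) (simp_all add: finite_leaves)
  finally show ?thesis by simp
qed

text \<open>Every arc lies on a root path, and induction along that path puts all its arcs into
  \<open>A\<close>. Applied to the traversal, this shows that no edge is missed.\<close>

lemma arcs_subset_of_closed:
  assumes "out_arcs T s \<subseteq> A" "\<And>e. e \<in> A \<Longrightarrow> out_arcs T (head T e) \<subseteq> A"
  shows "arcs T \<subseteq> A"
proof -
  have "set p \<subseteq> A" if "awalk s p v" for p v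
    using that
  proof (induction p arbitrary: v rule: rev_induct)
    case (snoc e p)
    have "awalk s p (tail T e)" and e: "e \<in> arcs T"
      using snoc.prems by (auto simp: awalk_simps)
    then have "set p \<subseteq> A" "tail T e = s \<or> (\<exists>e'\<in>set p. head T e' = tail T e)"
      using snoc.IH by (auto, cases p rule: rev_cases) (auto simp: awalk_simps)
    then show ?case
      using assms e by (fastforce simp: out_arcs_def)
  qed simp
  then have "set (root_path T s (head T e)) \<subseteq> A" if "e \<in> arcs T" for e
    using that awalk_root_path[of "head T e"] by simp
  then show ?thesis
    using root_path_head by fastforce
qed

section \<open>Traversal and leaf counts\<close>

text \<open>Stated with prefixes to match \<open>leaf_counts\<close>, which reads the list from the
  left: the counter at the head of \<open>e\<close> is final when \<open>e\<close> is
  reached.\<close>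

definition children_first :: "'e list \<Rightarrow> bool" where
  "children_first ord \<longleftrightarrow> (\<forall>ys e zs. ord = ys @ e # zs \<longrightarrow> out_arcs T (head T e) \<subseteq> set ys)"

text \<open>
  An edge costs 5 units of potential until it is pushed on the stack and 3 from then on until it is
  popped; the difference pays for pushing it.
\<close>

lemma bottom_up_halts:
  assumes adj: "\<And>v. distinct (adj v)" "\<And>v. set (adj v) = out_arcs T v"
  shows "halts_within (bottom_up s (head T) adj) (7 * card (arcs T) + 3)
    (\<lambda>ord. distinct ord \<and> set ord = arcs T \<and> children_first ord)"
proof -
  let ?n = "card (arcs T)"
  \<comment> \<open>The \<open>sorted_wrt\<close> condition says that no child of an edge comes
    after it in \<open>ord\<close>. The last conjunct says that the parent of every discovered edge
    has been popped; it yields that newly pushed edges are fresh.\<close>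
  define I where "I = (\<lambda>(st, ord). distinct (st @ ord) \<and> set (st @ ord) \<subseteq> arcs T \<and>
    sorted_wrt (\<lambda>e e'. head T e \<noteq> tail T e') ord \<and>
    out_arcs T s \<subseteq> set (st @ ord) \<and> (\<forall>e\<in>set ord. out_arcs T (head T e) \<subseteq> set (st @ ord)) \<and>
    (\<forall>e\<in>set (st @ ord). tail T e = s \<or> (\<exists>p\<in>set ord. head T p = tail T e)))"
  define \<phi> where "\<phi> = (\<lambda>(st :: 'e list, ord :: 'e list).
    5 * (?n - (length st + length ord)) + 3 * length st)"
  have length_adj: "length (adj v) = card (out_arcs T v)" for v
    using adj by (metis distinct_card)
  have init: "I (rev (adj s), [])"
    using adj by (auto simp: I_def)
  have card_s: "card (out_arcs T s) \<le> ?n"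
    by (rule card_mono) auto
  show ?thesis
    unfolding bottom_up_def
  proof (rule halts_within_bind_Halt[OF for_run_push_eq], rule halts_within_bind[OF
        while_halts_within[where I = I and \<phi> = \<phi>]])
    fix st assume st: "I st" "case st of (stack, ord) \<Rightarrow> stack \<noteq> []"
    obtain e st' ord where [simp]: "st = (e # st', ord)"
      using st by (cases st; cases "fst st") auto
    let ?ch = "adj (head T e)"
    have I: "distinct (e # st' @ ord)" "e \<in> arcs T" "set st' \<subseteq> arcs T" "set ord \<subseteq> arcs T"
      "sorted_wrt (\<lambda>e e'. head T e \<noteq> tail T e') ord" "out_arcs T s \<subseteq> insert e (set st' \<union> set ord)"
      "\<And>e'. e' \<in> set ord \<Longrightarrow> out_arcs T (head T e') \<subseteq> insert e (set st' \<union> set ord)"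
      "\<And>e'. e' \<in> insert e (set st' \<union> set ord) \<Longrightarrow>
        tail T e' = s \<or> (\<exists>p\<in>set ord. head T p = tail T e')"
      using st(1) by (auto simp: I_def)
    \<comment> \<open>Otherwise the popped parent of \<open>e'\<close> has the same head as
      \<open>e\<close>, hence equals \<open>e\<close>, although \<open>e\<close> is still on the
      stack.\<close>
    have fresh: "tail T e' \<noteq> head T e" if e': "e' \<in> insert e (set st' \<union> set ord)" for e'
    proof
      assume "tail T e' = head T e"
      then obtain p where "p \<in> set ord" "head T p = head T e"
        using I(8)[OF e'] head_neq_root[OF I(2)] by auto
      then show False
        using I(1,2,4) head_eq_iff by (metis Un_iff distinct.simps(2) set_append subsetD)
    qed
    then have disj: "set ?ch \<inter> insert e (set st' \<union> set ord) = {}"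
      using adj by (auto simp: out_arcs_def)
    have I': "I (rev ?ch @ st', e # ord)"
      unfolding I_def prod.case
    proof (intro conjI ballI)
      show "distinct ((rev ?ch @ st') @ e # ord)"
        using I(1) disj adj by auto
      show "set ((rev ?ch @ st') @ e # ord) \<subseteq> arcs T"
        using I(2-4) adj by auto
      show "sorted_wrt (\<lambda>e e'. head T e \<noteq> tail T e') (e # ord)"
        using I(5) fresh by (simp add: eq_commute)
      show "out_arcs T s \<subseteq> set ((rev ?ch @ st') @ e # ord)"
        using I(6) by auto
      show "out_arcs T (head T e') \<subseteq> set ((rev ?ch @ st') @ e # ord)" if "e' \<in> set (e # ord)" for e'
        using I(7)[of e'] that adj by (cases "e' = e") auto
      show "tail T e' = s \<or> (\<exists>p\<in>set (e # ord). head T p = tail T e')"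
        if "e' \<in> set ((rev ?ch @ st') @ e # ord)" for e'
        using I(8)[of e'] that adj by (cases "e' \<in> set ?ch") auto
    qed
    \<comment> \<open>This bound keeps the truncated subtraction in \<open>\<phi>\<close> exact. The
      pop releases 3 units and each push 2, which covers the loop, the final step and the
      guard.\<close>
    have "length (rev ?ch @ st' @ e # ord) = card (set (rev ?ch @ st' @ e # ord))"
      using I' by (intro distinct_card[symmetric]) (auto simp: I_def)
    also have "\<dots> \<le> ?n"
      using I' by (intro card_mono) (auto simp: I_def)
    finally have dec: "\<phi> (rev ?ch @ st', e # ord) + (2 * length ?ch + 2) + 1 \<le> \<phi> st"
      by (simp add: \<phi>_def)
    show "\<exists>t. halts_within (case st of (stack, ord) \<Rightarrow> do {
        stack' \<leftarrow> for_run (\<lambda>e st. step (e # st)) (adj (head T (hd stack))) (tl stack);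
        step (stack', hd stack # ord) }) t (\<lambda>y. I y \<and> \<phi> y + t + 1 \<le> \<phi> st)"
      unfolding for_run_push_eq unfolding charge_def
      using I' dec by (intro exI[of _ "2 * length ?ch + 2"]) simp
  next
    fix st assume "I st \<and> \<not> (case st of (stack, ord) \<Rightarrow> stack \<noteq> [])"
    then obtain ord where [simp]: "st = ([], ord)" and I: "I ([], ord)"
      by (cases st) auto
    have set_ord: "set ord = arcs T"
      using I arcs_subset_of_closed[of "set ord"] by (auto simp: I_def)
    moreover have "children_first ord"
      unfolding children_first_def
    proof (intro allI impI subsetI)
      fix ys e zs e' assume ord: "ord = ys @ e # zs" and e': "e' \<in> out_arcs T (head T e)"
      then have "e' \<in> set ord" "e \<in> arcs T" "e' \<noteq> e"
        using tail_neq_head set_ord by (auto simp: out_arcs_def)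
      then show "e' \<in> set ys"
        using I ord e' by (auto simp: I_def sorted_wrt_append out_arcs_def)
    qed
    ultimately show "halts_within (case st of (stack, ord) \<Rightarrow> step ord) 1
        (\<lambda>ord. distinct ord \<and> set ord = arcs T \<and> children_first ord)"
      using I by (simp add: I_def)
  qed (use init card_s in \<open>auto simp: \<phi>_def length_adj\<close>)
qed

text \<open>All children of an edge are processed before it, so its counter already holds the sum in
  \<open>card_leaves_below\<close>.\<close>

lemma leaf_counts_halts:
  assumes adj: "\<And>v. set (adj v) = out_arcs T v"
    and ord: "distinct ord" "set ord = arcs T" "children_first ord"
  shows "halts_within (leaf_counts (tail T) (head T) adj ord) (5 * length ord + 3)
    (\<lambda>l. \<forall>e\<in>arcs T. l e = card (leaves_below e))"
proof -
  define g where "g = (\<lambda>e (cnt, l).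
    let k = if adj (head T e) = [] then 1 else cnt (head T e)
    in (cnt(tail T e := cnt (tail T e) + k), l(e := k :: nat)))"
  \<comment> \<open>The loop invariant, for all prefixes of \<open>ord\<close>: \<open>cnt v\<close>
    sums over the processed edges leaving \<open>v\<close>.\<close>
  have counts: "fold g ys (\<lambda>_. 0, \<lambda>_. 0) =
      (\<lambda>v. \<Sum>e | e \<in> set ys \<and> tail T e = v. card (leaves_below e),
       \<lambda>e. if e \<in> set ys then card (leaves_below e) else 0)"
    if "ord = ys @ zs" for ys zs
    using that
  proof (induction ys arbitrary: zs rule: rev_induct)
    case (snoc e ys)
    let ?cnt = "\<lambda>ys v. \<Sum>e | e \<in> set ys \<and> tail T e = v. card (leaves_below e)"
    have e: "e \<in> arcs T" "e \<notin> set ys" "set ys \<subseteq> arcs T"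
      using ord snoc.prems by auto
    have "out_arcs T (head T e) \<subseteq> set ys"
      using ord(3) snoc.prems by (auto simp: children_first_def)
    then have "{e'. e' \<in> set ys \<and> tail T e' = head T e} = out_arcs T (head T e)"
      using e by (auto simp: out_arcs_def)
    then have k: "(if adj (head T e) = [] then 1 else ?cnt ys (head T e)) = card (leaves_below e)"
      using card_leaves_below[OF e(1)] adj[of "head T e"] by auto
    have "?cnt (ys @ [e]) = (?cnt ys)(tail T e := ?cnt ys (tail T e) + card (leaves_below e))"
    proof
      fix v
      have "{e'. e' \<in> set (ys @ [e]) \<and> tail T e' = v} =
          (if tail T e = v then insert e else id) {e'. e' \<in> set ys \<and> tail T e' = v}"
        by auto
      then show "?cnt (ys @ [e]) v =
          ((?cnt ys)(tail T e := ?cnt ys (tail T e) + card (leaves_below e))) v"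
        using e by simp
    qed
    then show ?case
      using snoc.IH[of "e # zs"] snoc.prems k by (auto simp: g_def Let_def fun_eq_iff)
  qed simp
  obtain cnt l where fold: "fold g ord (\<lambda>_. 0, \<lambda>_. 0) = (cnt, l)"
    by fastforce
  then have "l = (\<lambda>e. if e \<in> set ord then card (leaves_below e) else 0)"
    using counts[of ord "[]"] by simp
  then have "\<forall>e\<in>arcs T. l e = card (leaves_below e)"
    using ord by simp
  moreover have "for_run (\<lambda>e (cnt, l). do {
         k \<leftarrow> step (if adj (head T e) = [] then 1 else cnt (head T e));
         step (cnt(tail T e := cnt (tail T e) + k), l(e := k)) }) ord (cnt, l) =
       Halt (fold g ord (cnt, l)) (3 * length ord + 1)" for cnt l
    by (subst for_run_eq_fold[where g = g and k = 2]) (auto simp: charge_def g_def Let_def)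
  ultimately show ?thesis
    unfolding leaf_counts_def by (simp add: charge_def fold)
qed

section \<open>Optimality\<close>

lemma sum_below_threshold_optimal:
  assumes wuc: "\<And>e. e \<in> arcs T \<Longrightarrow> 0 \<le> w e \<and> w e \<le> u e \<and> 0 < c e"
    and \<alpha>: "distinct \<alpha>" "set \<alpha> = arcs T" "sorted (map c \<alpha>)" and k: "k < length \<alpha>"
  defines "S \<equiv> \<lambda>e. real (card (leaves_below e)) * (u e - w e)"
    and "x \<equiv> \<lambda>e. if e \<in> set (take (k + 1) \<alpha>) then u e else w e"
  assumes below: "sum S (set (take k \<alpha>)) < D - root_leaf_distance_sum T s w"
    and above: "D - root_leaf_distance_sum T s w \<le> sum S (set (take (k + 1) \<alpha>))"
  shows "optimal T s w u c D x" and "objective T w c x = c (\<alpha> ! k)"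
proof -
  \<comment> \<open>Used for the first \<open>k + 1\<close> edges to get feasibility, and for the
    first \<open>k\<close> edges to get the lower bound.\<close>
  have gain: "root_leaf_distance_sum T s (\<lambda>e. if e \<in> P then u e else w e) =
      root_leaf_distance_sum T s w + sum S P" if "P \<subseteq> arcs T" for P
  proof -
    have "root_leaf_distance_sum T s (\<lambda>e. if e \<in> P then u e else w e) =
        (\<Sum>e\<in>arcs T. real (card (leaves_below e)) * w e + (if e \<in> P then S e else 0))"
      unfolding root_leaf_distance_sum_eq by (rule sum.cong) (auto simp: S_def algebra_simps)
    also have "\<dots> = root_leaf_distance_sum T s w + sum S P"
      using that by (simp add: sum.distrib root_leaf_distance_sum_eq flip: sum.inter_restrict)
        (simp add: Int_absorb1)
    finally show ?thesis .
  qed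
  have P: "set (take j \<alpha>) \<subseteq> arcs T" for j
    using \<alpha> set_take_subset by metis
  have take_Suc: "set (take (k + 1) \<alpha>) = insert (\<alpha> ! k) (set (take k \<alpha>))"
    using k by (simp add: take_Suc_conv_app_nth)
  have arc_k: "\<alpha> ! k \<in> arcs T"
    using k \<alpha>(2) nth_mem by blast
  \<comment> \<open>The objective only counts edges whose weight really changes. The strict gap
    between \<open>g(k)\<close> and \<open>g(k + 1)\<close> shows that the last raised edge
    does.\<close>
  have "u (\<alpha> ! k) \<noteq> w (\<alpha> ! k)"
  proof
    assume "u (\<alpha> ! k) = w (\<alpha> ! k)"
    then have "S (\<alpha> ! k) = 0"
      by (simp add: S_def)
    then have "sum S (set (take (k + 1) \<alpha>)) = sum S (set (take k \<alpha>))"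
      unfolding take_Suc by (cases "\<alpha> ! k \<in> set (take k \<alpha>)") (simp_all add: insert_absorb)
    then show False
      using below above by simp
  qed
  then have attained: "c (\<alpha> ! k) = c (\<alpha> ! k) * hamming (x (\<alpha> ! k)) (w (\<alpha> ! k))"
    using take_Suc by (simp add: x_def hamming_def)
  have "c e * hamming (x e) (w e) \<le> c (\<alpha> ! k)" if "e \<in> arcs T" for e
  proof (cases "e \<in> set (take (k + 1) \<alpha>)")
    case True
    then obtain i where "i < k + 1" "e = \<alpha> ! i"
      using k by (auto simp: in_set_conv_nth)
    then have "c e \<le> c (\<alpha> ! k)"
      using \<alpha>(3) k sorted_nth_mono[of "map c \<alpha>" i k] by simp
    then show ?thesis
      using wuc[OF arc_k] by (simp add: hamming_def)
  next
    case False
    then show ?thesis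
      using wuc[OF arc_k] by (simp add: x_def hamming_def)
  qed
  then show obj: "objective T w c x = c (\<alpha> ! k)"
    unfolding objective_def using arc_k attained
    by (intro Max_eqI) (auto intro: image_eqI[of _ _ "\<alpha> ! k"])
  have "feasible T s w u D x"
    using gain[OF P[of "k + 1"]] above wuc by (auto simp: feasible_def x_def)
  moreover have "c (\<alpha> ! k) \<le> objective T w c y" if y: "feasible T s w u D y" for y
  proof (rule ccontr)
    assume less: "\<not> c (\<alpha> ! k) \<le> objective T w c y"
    \<comment> \<open>An edge changed by \<open>y\<close> costs less than
      \<open>c (\<alpha> ! k)\<close>, so by sortedness its position is before \<open>k\<close>.
      Thus \<open>y\<close> is dominated by raising the first \<open>k\<close> edges, which does not
      reach \<open>D\<close>.\<close>
    have "y e \<le> (if e \<in> set (take k \<alpha>) then u e else w e)" if e: "e \<in> arcs T" for e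
    proof (cases "y e = w e")
      case False
      then have "c e \<le> objective T w c y"
        unfolding objective_def using e
        by (intro Max_ge) (auto simp: hamming_def intro!: image_eqI[of _ _ e])
      then have "c e < c (\<alpha> ! k)"
        using less by simp
      moreover obtain i where i: "i < length \<alpha>" "e = \<alpha> ! i"
        using e \<alpha>(2) by (metis in_set_conv_nth)
      ultimately have "i < k"
        using \<alpha>(3) sorted_nth_mono[of "map c \<alpha>" k i] by force
      then have "e \<in> set (take k \<alpha>)"
        using i by (auto simp: in_set_conv_nth intro!: exI[of _ i])
      then show ?thesis
        using y e by (simp add: feasible_def)
    qed (use wuc e in auto)
    then have "root_leaf_distance_sum T s y \<le>
        root_leaf_distance_sum T s (\<lambda>e. if e \<in> set (take k \<alpha>) then u e else w e)"
      unfolding root_leaf_distance_sum_eq by (intro sum_mono mult_left_mono) auto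
    also have "\<dots> < D"
      using gain[OF P[of k]] below by simp
    finally show False
      using y by (simp add: feasible_def)
  qed
  ultimately show "optimal T s w u c D x"
    by (simp add: optimal_def obj)
qed

text \<open>The coefficients \<open>|L(e)|\<close> are nonnegative, so \<open>u\<close> maximizes
  the distance sum among all vectors within the bounds.\<close>

lemma infeasible_iff:
  assumes "\<And>e. e \<in> arcs T \<Longrightarrow> w e \<le> u e"
  shows "(\<nexists>y. feasible T s w u D y) \<longleftrightarrow> root_leaf_distance_sum T s u < D"
proof -
  have "root_leaf_distance_sum T s y \<le> root_leaf_distance_sum T s u" if "feasible T s w u D y" for y
    using that unfolding root_leaf_distance_sum_eq feasible_def
    by (intro sum_mono mult_left_mono) auto
  moreover have "feasible T s w u D u" if "D \<le> root_leaf_distance_sum T s u"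
    using that assms by (simp add: feasible_def)
  ultimately show ?thesis
    by (meson feasible_def leD leI order.trans)
qed

lemma unchanged_optimal:
  assumes "arcs T \<noteq> {}" "\<And>e. e \<in> arcs T \<Longrightarrow> w e \<le> u e \<and> 0 < c e"
    and "D \<le> root_leaf_distance_sum T s w"
  shows "optimal T s w u c D w" and "objective T w c w = 0"
proof -
  show obj: "objective T w c w = 0"
    using assms by (simp add: objective_def hamming_def image_constant_conv)
  obtain e where "e \<in> arcs T"
    using assms by auto
  then have "0 \<le> objective T w c y" for y
    unfolding objective_def using assms
    by (intro order.trans[OF _ Max_ge[of _ "c e * hamming (y e) (w e)"]])
      (auto simp: hamming_def less_imp_le)
  then show "optimal T s w u c D w"
    using assms by (simp add: optimal_def feasible_def obj)
qed

section \<open>Correctness and running time of the whole algorithm\<close>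

text \<open>Of the coefficient 12, sorting takes 3 and the search 9. As \<open>1 \<le> n\<close>,
  additive constants are absorbed into the generously rounded linear term.\<close>

lemma algorithm_A_halts:
  assumes "arcs T \<noteq> {}" and wuc: "\<And>e. e \<in> arcs T \<Longrightarrow> 0 \<le> w e \<and> w e \<le> u e \<and> 0 < c e"
    and es: "distinct es" "set es = arcs T"
  shows "halts_within (algorithm_A s es (tail T) (head T) (length es) w u c D)
    (12 * length es * ceillog2 (length es) + 60 * length es) (solves T s w u c D)"
proof -
  define n L where "n = length es" and "L = ceillog2 n"
  define adj where "adj = (\<lambda>v. rev (filter (\<lambda>e. tail T e = v) es))"
  have adj: "distinct (adj v)" "set (adj v) = out_arcs T v" for v
    using es by (auto simp: adj_def out_arcs_def)
  have n: "card (arcs T) = n" "1 \<le> n" "es \<noteq> []"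
    using es assms(1) by (auto simp: n_def distinct_card[symmetric] Suc_le_eq)
  have nL: "(4 * n + 5) * L \<le> 9 * n * L"
    using n by simp
  let ?W = "root_leaf_distance_sum T s"
  show ?thesis
    unfolding algorithm_A_def algorithm_A_from_def child_edges_eq n_def[symmetric] L_def[symmetric]
      adj_def[symmetric]
  proof (rule halts_within_bind_Halt[OF refl], rule halts_within_bind[OF bottom_up_halts[OF adj]])
    fix ord assume ord: "distinct ord \<and> set ord = arcs T \<and> children_first ord"
    then have "length ord = n"
      using n by (metis distinct_card)
    have leaf: "halts_within (leaf_counts (tail T) (head T) adj ord) (5 * n + 3)
        (\<lambda>l. \<forall>e\<in>arcs T. l e = card (leaves_below e))"
      using leaf_counts_halts[OF adj(2), of ord] ord \<open>length ord = n\<close> by simp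
    show "halts_within (do {
        l \<leftarrow> leaf_counts (tail T) (head T) adj ord;
        F \<leftarrow> charge n (\<lambda>_. 0);
        F \<leftarrow> for_run (\<lambda>e F. step (F(e := c e * (u e - w e)))) es F;
        wT \<leftarrow> sum_run (\<lambda>e. real (l e) * w e) es;
        \<Delta> \<leftarrow> step (D - wT);
        uT \<leftarrow> sum_run (\<lambda>e. real (l e) * u e) es;
        if uT < D then step (None, \<infinity>)
        else if wT \<ge> D then step (Some w, 0)
        else do {
          \<alpha> \<leftarrow> sort_run c es;
          k \<leftarrow> search 0 n (\<lambda>e. real (l e) * (u e - w e)) \<alpha> \<Delta>;
          x \<leftarrow> charge n w;
          x \<leftarrow> for_run (\<lambda>e x. step (x(e := u e))) (take (k + 1) \<alpha>) x;
          C \<leftarrow> charge (k + 1) (c (\<alpha> ! k));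
          step (Some x, ereal C) } }) (12 * n * L + 38 * n) (solves T s w u c D)"
    proof (rule halts_within_bind[OF leaf])
      fix l :: "'e \<Rightarrow> nat" assume l: "\<forall>e\<in>arcs T. l e = card (leaves_below e)"
      have weight: "sum_run (\<lambda>e. real (l e) * x e) es = Halt (?W x) (2 * n + 1)" for x
        using l es by (simp add: sum_run_eq n_def root_leaf_distance_sum_eq sum_list_distinct_conv_sum_set)
      have main: "halts_within (do {
          \<alpha> \<leftarrow> sort_run c es;
          k \<leftarrow> search 0 n (\<lambda>e. real (l e) * (u e - w e)) \<alpha> (D - ?W w);
          x \<leftarrow> charge n w;
          x \<leftarrow> for_run (\<lambda>e x. step (x(e := u e))) (take (k + 1) \<alpha>) x;
          C \<leftarrow> charge (k + 1) (c (\<alpha> ! k));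
          step (Some x, ereal C) }) (12 * n * L + 9 * n) (solves T s w u c D)"
        if D: "\<not> ?W u < D" "\<not> D \<le> ?W w"
      proof (rule halts_within_bind[OF sort_run_halts[OF \<open>es \<noteq> []\<close>]])
        fix \<alpha> assume \<alpha>: "mset \<alpha> = mset es \<and> sorted (map c \<alpha>)"
        then have \<alpha>': "distinct \<alpha>" "set \<alpha> = arcs T" "sorted (map c \<alpha>)" "length \<alpha> = n"
          using es by (auto simp: n_def dest: mset_eq_imp_distinct_iff mset_eq_setD mset_eq_length)
        define S where "S = (\<lambda>e. real (card (leaves_below e)) * (u e - w e))"
        have g: "sum_list (map (\<lambda>e. real (l e) * (u e - w e)) (take k \<alpha>)) = sum S (set (take k \<alpha>))" for k
          using l \<alpha>' set_take_subset[of k \<alpha>]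
          by (auto simp: S_def sum_list_distinct_conv_sum_set intro!: sum.cong)
        \<comment> \<open>Raising all edges turns \<open>w(T)\<close> into \<open>u(T)\<close>. So
          surviving the two early exits means \<open>0 < \<Delta>\<close> and
          \<open>\<Delta> \<le> g(n)\<close>, as the search requires.\<close>
        have "sum S (arcs T) = ?W u - ?W w"
          by (simp add: S_def root_leaf_distance_sum_eq algebra_simps sum_subtractf)
        then have search: "halts_within (search 0 n (\<lambda>e. real (l e) * (u e - w e)) \<alpha> (D - ?W w))
            ((4 * n + 5) * L + 2) (\<lambda>k. k < n \<and> sum S (set (take k \<alpha>)) < D - ?W w \<and>
              D - ?W w \<le> sum S (set (take (k + 1) \<alpha>)))"
          using search_halts[of "D - ?W w" "\<lambda>e. real (l e) * (u e - w e)" \<alpha>] D \<alpha>'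
          unfolding g by (simp add: L_def)
        show "halts_within (do {
            k \<leftarrow> search 0 n (\<lambda>e. real (l e) * (u e - w e)) \<alpha> (D - ?W w);
            x \<leftarrow> charge n w;
            x \<leftarrow> for_run (\<lambda>e x. step (x(e := u e))) (take (k + 1) \<alpha>) x;
            C \<leftarrow> charge (k + 1) (c (\<alpha> ! k));
            step (Some x, ereal C) }) (9 * n * L + 8 * n) (solves T s w u c D)"
        proof (rule halts_within_bind[OF search])
          fix k assume k: "k < n \<and> sum S (set (take k \<alpha>)) < D - ?W w \<and>
              D - ?W w \<le> sum S (set (take (k + 1) \<alpha>))"
          show "halts_within (do {
              x \<leftarrow> charge n w;
              x \<leftarrow> for_run (\<lambda>e x. step (x(e := u e))) (take (k + 1) \<alpha>) x;
              C \<leftarrow> charge (k + 1) (c (\<alpha> ! k));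
              step (Some x, ereal C) }) (4 * n + 2) (solves T s w u c D)"
            unfolding for_run_update_eq unfolding charge_def
            using k \<alpha>' sum_below_threshold_optimal[OF wuc \<alpha>'(1-3), of k D]
            by (simp add: solves_def S_def)
        qed (use nL n in linarith)
      qed (use n in \<open>simp add: n_def[symmetric] L_def[symmetric]\<close>)
      have branch: "halts_within (if ?W u < D then step (None, \<infinity>)
          else if ?W w \<ge> D then step (Some w, 0)
          else do {
            \<alpha> \<leftarrow> sort_run c es;
            k \<leftarrow> search 0 n (\<lambda>e. real (l e) * (u e - w e)) \<alpha> (D - ?W w);
            x \<leftarrow> charge n w;
            x \<leftarrow> for_run (\<lambda>e x. step (x(e := u e))) (take (k + 1) \<alpha>) x;
            C \<leftarrow> charge (k + 1) (c (\<alpha> ! k));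
            step (Some x, ereal C) }) (12 * n * L + 9 * n) (solves T s w u c D)"
        using main infeasible_iff[of w u D] unchanged_optimal[of w u c D] assms n
        by (auto simp: solves_def zero_ereal_def)
      show "halts_within (do {
          F \<leftarrow> charge n (\<lambda>_. 0);
          F \<leftarrow> for_run (\<lambda>e F. step (F(e := c e * (u e - w e)))) es F;
          wT \<leftarrow> sum_run (\<lambda>e. real (l e) * w e) es;
          \<Delta> \<leftarrow> step (D - wT);
          uT \<leftarrow> sum_run (\<lambda>e. real (l e) * u e) es;
          if uT < D then step (None, \<infinity>)
          else if wT \<ge> D then step (Some w, 0)
          else do {
            \<alpha> \<leftarrow> sort_run c es;
            k \<leftarrow> search 0 n (\<lambda>e. real (l e) * (u e - w e)) \<alpha> \<Delta>;
            x \<leftarrow> charge n w;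
            x \<leftarrow> for_run (\<lambda>e x. step (x(e := u e))) (take (k + 1) \<alpha>) x;
            C \<leftarrow> charge (k + 1) (c (\<alpha> ! k));
            step (Some x, ereal C) } }) (12 * n * L + 30 * n) (solves T s w u c D)"
        by (rule halts_within_bind_Halt[OF charge_def],
            rule halts_within_bind_Halt[OF for_run_update_eq],
            rule halts_within_bind_Halt[OF weight],
            rule halts_within_bind_Halt[OF charge_def],
            rule halts_within_bind_Halt[OF weight],
            rule branch, (rule order.refl)+, use n in \<open>simp add: n_def[symmetric]\<close>)
    qed (use n in linarith)
  qed (rule order.refl, use n in linarith)
qed

end

section \<open>Asymptotics of the explicit bound\<close>

lemma n_ceillog2_bigo: "(\<lambda>n. real (12 * n * ceillog2 n + 60 * n)) \<in> O(\<lambda>n. real n * ln (real n))"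
proof -
  have "(\<lambda>n. real (12 * n * ceillog2 n + 60 * n)) \<in>
      O(\<lambda>n. 12 * real n * (log 2 (real n) + 1) + 60 * real n)"
  proof (rule landau_o.big_mono, rule eventually_mono[OF eventually_gt_at_top[of 0]])
    fix n :: nat assume n: "n > 0"
    have "real n * real (ceillog2 n) \<le> real n * (log 2 (real n) + 1)"
      using ceillog2_less_log[OF n] by (intro mult_left_mono) auto
    then show "norm (real (12 * n * ceillog2 n + 60 * n)) \<le>
        norm (12 * real n * (log 2 (real n) + 1) + 60 * real n)"
      using n by (simp add: abs_of_nonneg)
  qed
  also have "(\<lambda>n. 12 * real n * (log 2 (real n) + 1) + 60 * real n) \<in> O(\<lambda>n. real n * ln (real n))"
    unfolding log_def by real_asymp
  finally show ?thesis .
qed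

theorem lemma10:
  shows "\<exists>f :: nat \<Rightarrow> nat.
    (\<lambda>n. real (f n)) \<in> O(\<lambda>n. real n * ln (real n)) \<and>
    (\<forall>(T :: ('v, 'e) pre_digraph) s w u c D es.
       mcsdipt_instance T s w u c \<longrightarrow> distinct es \<longrightarrow> set es = arcs T \<longrightarrow>
       (\<exists>ans t. algorithm_A s es (tail T) (head T) (length es) w u c D = Halt ans t \<and>
                solves T s w u c D ans \<and> t \<le> f (length es)))"
proof (rule exI[of _ "\<lambda>n. 12 * n * ceillog2 n + 60 * n"], intro conjI allI impI)
  show "(\<lambda>n. real (12 * n * ceillog2 n + 60 * n)) \<in> O(\<lambda>n. real n * ln (real n))"
    by (rule n_ceillog2_bigo)
  fix T :: "('v, 'e) pre_digraph" and s w u c D es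
  assume inst: "mcsdipt_instance T s w u c" and es: "distinct es" "set es = arcs T"
  then interpret rooted_digraph T s
    by (auto simp: mcsdipt_instance_def rooted_tree_def rooted_digraph_def rooted_digraph_axioms_def)
  show "\<exists>ans t. algorithm_A s es (tail T) (head T) (length es) w u c D = Halt ans t \<and>
      solves T s w u c D ans \<and> t \<le> 12 * length es * ceillog2 (length es) + 60 * length es"
    using algorithm_A_halts[OF _ _ es, of w u c D] inst
    by (auto simp: mcsdipt_instance_def halts_within_def)
qed

end
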